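(* For any positive integers $n,r$ with $r\le n$, there exists an $n$-vertex directed graph $G$ with a set $S$ of $r$ vertices such that any 2-fault-tolerant reachability oracle of $G$ for the pair set $S\times S$ must have size $\Omega(n|S|)$ bits.
   Context: A $k$-fault-tolerant reachability oracle of $G=(V,E)$ for $\mathcal{P}\subseteq V\times V$ is a data structure that, given any $(s,t)\in\mathcal{P}$ and any set $F\subseteq E$ of at most $k$ edges, decides whether $t$ is reachable from $s$ in $G\setminus F$.
   Formalization: The bound is claimed only for r ≥ 2, since for r = 1 the only pair (s,s) is always reachable and an oracle needs no bits; the oracle's query procedure is fixed before G, as otherwise all answers could be built into it. *)

theory Defs
  imports Complex_Main "Graph_Theory.Pair_Digraph"
begin

definition del_arcs :: "'a pair_pre_digraph \<Rightarrow> ('a \<times> 'a) set \<Rightarrow> 'a pair_pre_digraph" where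
  "del_arcs G F = G\<lparr>parcs := parcs G - F\<rparr>"

text \<open>
  A data structure is a finite bit string, read by a query procedure that sees the stored
  bits and the query \<open>(s, t)\<close>, \<open>F\<close>, but not the graph.  The procedure is an arbitrary function,
  with no computability or running time restriction, so a lower bound on the number of stored
  bits holds in every model of computation.
\<close>

type_synonym 'a query_procedure = "bool list \<Rightarrow> 'a \<times> 'a \<Rightarrow> ('a \<times> 'a) set \<Rightarrow> bool"

text \<open>
  \<open>D\<close>, read by \<open>query\<close>, is a \<open>k\<close>-fault-tolerant reachability oracle of \<open>G\<close> for the pair set \<open>P\<close>.
  Answers are unconstrained for pairs outside \<open>P\<close>, for \<open>F\<close> containing a non-edge, and for more
  than \<open>k\<close> faults.
\<close>

definition ft_reachability_oracle ::
  "nat \<Rightarrow> 'a query_procedure \<Rightarrow> 'a pair_pre_digraph \<Rightarrow> ('a \<times> 'a) set \<Rightarrow> bool list \<Rightarrow> bool" where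
  "ft_reachability_oracle k query G P D \<longleftrightarrow>
     (\<forall>s t F. (s, t) \<in> P \<longrightarrow> F \<subseteq> parcs G \<longrightarrow> card F \<le> k \<longrightarrow>
        query D (s, t) F = reachable (with_proj (del_arcs G F)) s t)"

text \<open>
  Conventions for the lower bound.

  The query procedure has to be fixed before the graph: a procedure chosen after the graph could
  have all answers built in and would need no stored bits.  It may depend on \<open>n\<close> and \<open>r\<close>.

  The vertex set is \<open>{0..<n}\<close>, so that no information is hidden in vertex names.

  The bound is asymptotic, with an absolute constant, and is required from \<open>r = 2\<close> on.  For \<open>r = 1\<close>
  the only query pair is \<open>(s, s)\<close>, which is always answered positively, so that the empty bit
  string is an oracle of every graph.
\<close>

end

theory Submission
  imports Defs
begin

text \<open>
  With \<open>p = r div 2\<close> and \<open>m = n div (2 * p)\<close>, let each of \<open>p\<close> sources start, and each of \<open>p\<close>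
  targets end, a path on \<open>m\<close> vertices.  For every source \<open>i\<close>, target \<open>j\<close> and position \<open>x\<close> there is
  an optional arc from position \<open>x\<close> of path \<open>i\<close> to position \<open>x\<close> of path \<open>j\<close>.  Cutting path \<open>i\<close>
  right after position \<open>x\<close> and path \<open>j\<close> right before it leaves only that optional arc to get from
  source \<open>i\<close> to target \<open>j\<close>, so two faults read off each of the \<open>p * p * m\<close> independent bits.
  All faults used are path arcs, which are present in every graph of the family; hence an oracle
  determines its graph within the family, and counting bit strings gives the bound.
\<close>

section \<open>Counting oracles\<close>

text \<open>The count is 1 + 2 + ... + 2^(L-1) = 2^L - 1; its strictness is what the pigeonhole step
  uses.\<close>

lemma finite_card_bool_lists_shorter:
  "finite {D :: bool list. length D < L} \<and> card {D :: bool list. length D < L} < 2 ^ L"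
proof (induction L)
  case 0
  then show ?case by simp
next
  case (Suc L)
  let ?E = "{D :: bool list. set D \<subseteq> UNIV \<and> length D = L}"
  have eq: "{D :: bool list. length D < Suc L} = {D. length D < L} \<union> ?E"
    by auto
  have E: "finite ?E" "card ?E = 2 ^ L"
    using finite_lists_length_eq[of "UNIV :: bool set" L] card_lists_length_eq[of "UNIV :: bool set" L]
    by simp_all
  have "card {D :: bool list. length D < Suc L} \<le> card {D :: bool list. length D < L} + card ?E"
    unfolding eq by (rule card_Un_le)
  then show ?case
    using Suc E unfolding eq by simp
qed

text \<open>A single string cannot serve two graphs of the family, since some query that is legal
  for both has different answers. If every graph had an oracle shorter than \<open>L\<close>,
  choosing one for each would inject \<open>I\<close> into fewer than \<open>2 ^ L\<close>
  strings.\<close>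

lemma ft_reachability_oracle_length:
  assumes card: "2 ^ L \<le> card I"
    and separated: "\<And>B C. B \<in> I \<Longrightarrow> C \<in> I \<Longrightarrow> B \<noteq> C \<Longrightarrow>
      \<exists>s t F. (s, t) \<in> P \<and> F \<subseteq> parcs (g B) \<and> F \<subseteq> parcs (g C) \<and> card F \<le> k \<and>
        reachable (with_proj (del_arcs (g B) F)) s t \<noteq> reachable (with_proj (del_arcs (g C) F)) s t"
  obtains B where "B \<in> I" "\<And>D. ft_reachability_oracle k query (g B) P D \<Longrightarrow> L \<le> length D"
proof -
  have "\<exists>B\<in>I. \<forall>D. ft_reachability_oracle k query (g B) P D \<longrightarrow> L \<le> length D"
  proof (rule ccontr)
    assume "\<not> ?thesis"
    then have "\<forall>B\<in>I. \<exists>D. ft_reachability_oracle k query (g B) P D \<and> length D < L"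
      by (simp add: not_le)
    then obtain d where d: "\<And>B. B \<in> I \<Longrightarrow> ft_reachability_oracle k query (g B) P (d B)"
      and short: "\<And>B. B \<in> I \<Longrightarrow> length (d B) < L"
      by metis
    have "inj_on d I"
    proof (rule inj_onI, rule ccontr)
      fix B C assume "B \<in> I" "C \<in> I" "d B = d C" "B \<noteq> C"
      then show False
        using separated[of B C] d[of B] d[of C] unfolding ft_reachability_oracle_def by metis
    qed
    then have "card I \<le> card {D :: bool list. length D < L}"
      using short finite_card_bool_lists_shorter by (intro card_inj_on_le[of d]) auto
    then show False
      using card finite_card_bool_lists_shorter[of L] by linarith
  qed
  then show thesis
    using that by blast
qed

section \<open>The family of graphs\<close>

text \<open>Row-major numbering of a grid with rows of length \<open>m\<close>, so that the vertices
  are numbers below \<open>n\<close>; it is injective only for positions below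
  \<open>m\<close>.\<close>

definition vtx :: "nat \<Rightarrow> nat \<Rightarrow> nat \<Rightarrow> nat" where
  "vtx m i x = i * m + x"

text \<open>Rows \<open>i < p\<close> are the paths leaving the sources, rows \<open>p + j\<close> those entering the targets.\<close>

definition chain_arcs :: "nat \<Rightarrow> nat \<Rightarrow> (nat \<times> nat) set" where
  "chain_arcs p m = {(vtx m i x, vtx m i (Suc x)) | i x. i < 2 * p \<and> Suc x < m}"

definition rung_arcs :: "nat \<Rightarrow> nat \<Rightarrow> (nat \<times> nat \<times> nat) set \<Rightarrow> (nat \<times> nat) set" where
  "rung_arcs p m B = {(vtx m i x, vtx m (p + j) x) | i j x. (i, j, x) \<in> B}"

definition ladder :: "nat \<Rightarrow> nat \<Rightarrow> nat \<Rightarrow> (nat \<times> nat \<times> nat) set \<Rightarrow> nat pair_pre_digraph" where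
  "ladder n p m B = \<lparr>pverts = {0..<n}, parcs = chain_arcs p m \<union> rung_arcs p m B\<rparr>"

text \<open>The first part is empty at the last position and the second at \<open>x = 0\<close>,
  where the path has no arc to cut. A non-edge among the faults would leave the oracle's answer
  unconstrained.\<close>

definition cut :: "nat \<Rightarrow> nat \<Rightarrow> nat \<Rightarrow> nat \<Rightarrow> nat \<Rightarrow> (nat \<times> nat) set" where
  "cut p m i j x =
     {(u, w). u = vtx m i x \<and> w = vtx m i (Suc x) \<and> Suc x < m} \<union>
     {(vtx m (p + j) y, vtx m (p + j) (Suc y)) | y. Suc y = x}"

definition slots :: "nat \<Rightarrow> nat \<Rightarrow> (nat \<times> nat \<times> nat) set" where
  "slots p m = {..<p} \<times> {..<p} \<times> {..<m}"

lemma vtx_eq_iff: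
  assumes "x < m" "y < m"
  shows "vtx m i x = vtx m j y \<longleftrightarrow> i = j \<and> x = y"
proof
  assume eq: "vtx m i x = vtx m j y"
  have "i = vtx m i x div m" "x = vtx m i x mod m" "j = vtx m j y div m" "y = vtx m j y mod m"
    using assms by (simp_all add: vtx_def)
  then show "i = j \<and> x = y"
    unfolding eq by simp
qed simp

lemma vtx_less:
  assumes "i < q" "x < m" "q * m \<le> n"
  shows "vtx m i x < n"
proof -
  have "vtx m i x < Suc i * m"
    using assms unfolding vtx_def by simp
  also have "Suc i * m \<le> q * m"
    using assms by (intro mult_le_mono1) simp
  finally show ?thesis
    using assms by simp
qed

lemma pair_digraph_ladder:
  assumes "2 * p * m \<le> n" "B \<subseteq> slots p m"
  shows "pair_digraph (ladder n p m B)"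
proof -
  let ?G = "ladder n p m B"
  have arcs: "fst e < n \<and> snd e < n \<and> fst e \<noteq> snd e" if "e \<in> parcs ?G" for e
  proof -
    consider i x where "e = (vtx m i x, vtx m i (Suc x))" "i < 2 * p" "Suc x < m"
      | i j x where "e = (vtx m i x, vtx m (p + j) x)" "i < p" "j < p" "x < m"
      using \<open>e \<in> parcs ?G\<close> \<open>B \<subseteq> slots p m\<close>
      unfolding ladder_def chain_arcs_def rung_arcs_def slots_def by fastforce
    then show ?thesis
    proof cases
      case 1
      then show ?thesis
        using vtx_less[of i "2 * p" _ m n] assms(1) by (simp add: vtx_eq_iff)
    next
      case 2
      then show ?thesis
        using vtx_less[of i "2 * p" x m n] vtx_less[of "p + j" "2 * p" x m n] assms(1)
        by (simp add: vtx_eq_iff)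
    qed
  qed
  then have "parcs ?G \<subseteq> {0..<n} \<times> {0..<n}"
    by force
  then have "finite (parcs ?G)"
    using finite_subset by blast
  then show ?thesis
    using arcs by unfold_locales (auto simp: ladder_def)
qed

section \<open>Two-fault cuts and the rung they isolate\<close>

lemma chain_arcsI: "i < 2 * p \<Longrightarrow> Suc x < m \<Longrightarrow> (vtx m i x, vtx m i (Suc x)) \<in> chain_arcs p m"
  unfolding chain_arcs_def by blast

lemma cut_subset_chain_arcs: "i < p \<Longrightarrow> j < p \<Longrightarrow> x < m \<Longrightarrow> cut p m i j x \<subseteq> chain_arcs p m"
  unfolding cut_def by (auto intro!: chain_arcsI)

lemma card_cut_le: "card (cut p m i j x) \<le> 2"
proof -
  \<comment> \<open>For \<open>x = 0\<close> the truncated \<open>x - 1\<close> does no harm: the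
    second part of the cut is then empty.\<close>
  have "cut p m i j x
    \<subseteq> {(vtx m i x, vtx m i (Suc x)), (vtx m (p + j) (x - 1), vtx m (p + j) x)}"
    unfolding cut_def by auto
  then have "card (cut p m i j x) \<le> card \<dots>"
    by (intro card_mono) simp_all
  also have "\<dots> \<le> 2"
    by (simp add: card_insert_if)
  finally show ?thesis .
qed

lemma chain_arc_in_cut_iff:
  assumes "i < p" "x < m" "Suc y < m"
  shows "(vtx m k y, vtx m k (Suc y)) \<in> cut p m i j x \<longleftrightarrow>
    k = i \<and> y = x \<or> k = p + j \<and> Suc y = x"
  using assms unfolding cut_def by (auto simp: vtx_eq_iff)

lemma rung_arc_notin_cut:
  assumes "i < p" "x < m" "k < p" "y < m"
  shows "(vtx m k y, vtx m (p + l) y) \<notin> cut p m i j x"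
  using assms unfolding cut_def by (auto simp: vtx_eq_iff)

text \<open>Row \<open>i\<close> can be left only by rungs at positions up to \<open>x\<close>.
  Those into row \<open>p + j\<close> arrive strictly before \<open>x\<close>, because the one at
  \<open>x\<close> is absent, and the second fault blocks the way on.\<close>

lemma ladder_not_reachable:
  assumes B: "B \<subseteq> slots p m" and x: "i < p" "j < p" "x < m" and notin: "(i, j, x) \<notin> B"
  shows "\<not> reachable (with_proj (del_arcs (ladder n p m B) (cut p m i j x)))
    (vtx m i 0) (vtx m (p + j) (m - 1))"
proof
  let ?H = "del_arcs (ladder n p m B) (cut p m i j x)"
  \<comment> \<open>An invariant closed under the surviving arcs. Target rows other than
    \<open>p + j\<close> need no bound on the position, since no rung leaves a target row.\<close>
  let ?Q = "\<lambda>u. \<exists>k y. u = vtx m k y \<and> y < m \<and> (k = i \<and> y \<le> x \<or> p \<le> k \<and> (k = p + j \<longrightarrow> y < x))"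
  assume "reachable (with_proj ?H) (vtx m i 0) (vtx m (p + j) (m - 1))"
  then have "(vtx m i 0, vtx m (p + j) (m - 1)) \<in> rtrancl_on (pverts ?H) (parcs ?H)"
    by (simp add: reachable_def)
  then have "?Q (vtx m (p + j) (m - 1))"
  proof (induction rule: rtrancl_on_induct)
    case base
    then show ?case using x by force
  next
    case (step u w)
    from \<open>?Q u\<close> obtain k y where u: "u = vtx m k y" "y < m"
      and ky: "k = i \<and> y \<le> x \<or> p \<le> k \<and> (k = p + j \<longrightarrow> y < x)"
      by blast
    have uw: "(u, w) \<in> chain_arcs p m \<union> rung_arcs p m B" "(u, w) \<notin> cut p m i j x"
      using step by (auto simp: del_arcs_def ladder_def)
    from uw(1) show ?case
    proof
      assume "(u, w) \<in> chain_arcs p m"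
      then obtain k' y' where "u = vtx m k' y'" "w = vtx m k' (Suc y')" "Suc y' < m"
        unfolding chain_arcs_def by blast
      then have w: "w = vtx m k (Suc y)" and y: "Suc y < m"
        using u vtx_eq_iff[of y' m y k' k] by auto
      have "\<not> (k = i \<and> y = x \<or> k = p + j \<and> Suc y = x)"
        using uw(2) chain_arc_in_cut_iff[OF x(1,3) y] unfolding u(1) w by blast
      then have "k = i \<and> Suc y \<le> x \<or> p \<le> k \<and> (k = p + j \<longrightarrow> Suc y < x)"
        using ky by auto
      then show ?case
        using w y by blast
    next
      assume "(u, w) \<in> rung_arcs p m B"
      then obtain k' l y' where rung: "u = vtx m k' y'" "w = vtx m (p + l) y'" "(k', l, y') \<in> B"
        unfolding rung_arcs_def by blast
      then have "k' < p" "y' < m"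
        using B unfolding slots_def by auto
      \<comment> \<open>Rungs start in source rows, which rules out the case
        \<open>p \<le> k\<close>.\<close>
      then have "k' = i" "y' \<le> x"
        using u ky rung(1) vtx_eq_iff[of y' m y k' k] by auto
      then have "p + l = p + j \<longrightarrow> y' < x"
        using rung(3) notin by (cases "y' = x") auto
      then show ?case
        using rung(2) \<open>y' < m\<close> by (intro exI[of _ "p + l"] exI[of _ y']) simp
    qed
  qed
  then show False
    using x by (auto simp: vtx_eq_iff)
qed

text \<open>The walk follows row \<open>i\<close> up to \<open>x\<close>, takes the rung, and
  follows row \<open>p + j\<close> to its end. The faults lie just after \<open>x\<close> in row
  \<open>i\<close> and just before \<open>x\<close> in row \<open>p + j\<close>, so the walk avoids
  both.\<close>

lemma ladder_reachable:
  assumes n: "2 * p * m \<le> n" and B: "B \<subseteq> slots p m" and x: "i < p" "j < p" "x < m"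
    and isin: "(i, j, x) \<in> B"
  shows "reachable (with_proj (del_arcs (ladder n p m B) (cut p m i j x)))
    (vtx m i 0) (vtx m (p + j) (m - 1))"
proof -
  let ?H = "del_arcs (ladder n p m B) (cut p m i j x)"
  let ?R = "rtrancl_on (pverts ?H) (parcs ?H)"
  have verts: "vtx m k y \<in> pverts ?H" if "k < 2 * p" "y < m" for k y
    using vtx_less[OF that n] by (simp add: del_arcs_def ladder_def)
  have chain: "(vtx m k y, vtx m k (Suc y)) \<in> parcs ?H"
    if "k < 2 * p" "Suc y < m" "\<not> (k = i \<and> y = x \<or> k = p + j \<and> Suc y = x)" for k y
    using that chain_arc_in_cut_iff[OF x(1,3) that(2)]
    by (auto simp: del_arcs_def ladder_def intro: chain_arcsI)
  have "(vtx m i 0, vtx m i y) \<in> ?R" if "y \<le> x" for y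
    using that
  proof (induction y)
    case 0
    then show ?case using verts x by simp
  next
    case (Suc y)
    then show ?case
      using x by (intro rtrancl_on_into_rtrancl_on[OF Suc.IH] chain verts) auto
  qed
  moreover have "(vtx m i x, vtx m (p + j) x) \<in> parcs ?H"
    using isin rung_arc_notin_cut[OF x(1,3) x(1,3)]
    by (auto simp: del_arcs_def ladder_def rung_arcs_def)
  moreover have "vtx m (p + j) x \<in> pverts ?H"
    using verts x by simp
  ultimately have mid: "(vtx m i 0, vtx m (p + j) x) \<in> ?R"
    by (blast intro: rtrancl_on_into_rtrancl_on)
  have "(vtx m i 0, vtx m (p + j) (m - 1)) \<in> ?R"
  proof (rule dec_induct[of x "m - 1"])
    show "x \<le> m - 1" using x by simp
    show "(vtx m i 0, vtx m (p + j) x) \<in> ?R" by (rule mid)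
    fix y assume y: "x \<le> y" "y < m - 1" "(vtx m i 0, vtx m (p + j) y) \<in> ?R"
    show "(vtx m i 0, vtx m (p + j) (Suc y)) \<in> ?R"
      using x y by (intro rtrancl_on_into_rtrancl_on[OF y(3)] chain verts) auto
  qed
  then show ?thesis
    by (simp add: reachable_def)
qed

section \<open>From the ladder family to the bit bound\<close>

lemma ladder_oracle_length:
  assumes n: "2 * p * m \<le> n"
    and S: "\<And>i. i < p \<Longrightarrow> vtx m i 0 \<in> S" "\<And>j. j < p \<Longrightarrow> vtx m (p + j) (m - 1) \<in> S"
  obtains B where "B \<subseteq> slots p m"
    "\<And>D. ft_reachability_oracle 2 query (ladder n p m B) (S \<times> S) D \<Longrightarrow> p * p * m \<le> length D"
proof (rule ft_reachability_oracle_length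
    [of "p * p * m" "Pow (slots p m)" "S \<times> S" "ladder n p m" 2 query])
  have "finite (slots p m)" "card (slots p m) = p * p * m"
    by (simp_all add: slots_def)
  then show "2 ^ (p * p * m) \<le> card (Pow (slots p m))"
    by (simp add: card_Pow)
next
  \<comment> \<open>Any triple on which \<open>B\<close> and \<open>C\<close> differ selects the
    separating query. Its faults are chain arcs, hence edges of both graphs.\<close>
  fix B C assume BC: "B \<in> Pow (slots p m)" "C \<in> Pow (slots p m)" "B \<noteq> C"
  then obtain i j x where ijx: "(i, j, x) \<in> B \<longleftrightarrow> (i, j, x) \<notin> C"
    by (metis prod_cases3 subsetI subset_antisym)
  then have x: "i < p" "j < p" "x < m"
    using BC unfolding slots_def by auto
  let ?F = "cut p m i j x" and ?s = "vtx m i 0" and ?t = "vtx m (p + j) (m - 1)"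
  have reach: "reachable (with_proj (del_arcs (ladder n p m A) ?F)) ?s ?t \<longleftrightarrow> (i, j, x) \<in> A"
    if "A \<in> Pow (slots p m)" for A
  proof (cases "(i, j, x) \<in> A")
    case True
    then show ?thesis
      using ladder_reachable[OF n _ x True] that by simp
  next
    case False
    then show ?thesis
      using ladder_not_reachable[OF _ x False] that by simp
  qed
  have sub: "?F \<subseteq> parcs (ladder n p m A)" for A
    using cut_subset_chain_arcs[OF x] by (auto simp: ladder_def)
  show "\<exists>s t F. (s, t) \<in> S \<times> S \<and> F \<subseteq> parcs (ladder n p m B) \<and> F \<subseteq> parcs (ladder n p m C) \<and>
      card F \<le> 2 \<and> reachable (with_proj (del_arcs (ladder n p m B) F)) s t \<noteq>
        reachable (with_proj (del_arcs (ladder n p m C) F)) s t"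
  proof (intro exI conjI)
    show "(?s, ?t) \<in> S \<times> S"
      using S x by blast
    show "reachable (with_proj (del_arcs (ladder n p m B) ?F)) ?s ?t \<noteq>
        reachable (with_proj (del_arcs (ladder n p m C) ?F)) ?s ?t"
      using reach[OF BC(1)] reach[OF BC(2)] ijx by blast
  qed (rule sub card_cut_le)+
next
  fix B assume "B \<in> Pow (slots p m)"
    "\<And>D. ft_reachability_oracle 2 query (ladder n p m B) (S \<times> S) D \<Longrightarrow> p * p * m \<le> length D"
  then show thesis
    using that by blast
qed

text \<open>Rounding costs constant factors: \<open>r \<le> 3 * p\<close>, with equality at
  \<open>r = 3\<close>, and \<open>n < 2 * p * m + 2 * p \<le> 4 * p * m\<close>. Their product
  gives the 12.\<close>

lemma bits_lower_bound:
  fixes n r :: nat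
  assumes "2 \<le> r" "r \<le> n"
  defines "p \<equiv> r div 2" and "m \<equiv> n div (2 * (r div 2))"
  shows "n * r \<le> 12 * (p * p * m)"
proof -
  have p: "0 < p" "r \<le> 3 * p" "2 * p \<le> n"
    using assms by auto
  have "1 \<le> m"
    using p div_le_mono[of "2 * p" n "2 * p"] unfolding m_def p_def by simp
  then have "2 * p \<le> 2 * p * m"
    by simp
  moreover have "n < 2 * p * m + 2 * p"
    using p dividend_less_times_div[of "2 * p" n] unfolding m_def p_def by simp
  ultimately have "n \<le> 4 * (p * m)"
    unfolding mult.assoc by linarith
  then have "n * r \<le> 4 * (p * m) * (3 * p)"
    using p(2) by (rule mult_le_mono)
  then show ?thesis
    by (simp add: mult_ac)
qed

theorem theorem8p4:
  shows "\<exists>c::real. c > 0 \<and>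
    (\<forall>n r :: nat. 0 < n \<longrightarrow> 0 < r \<longrightarrow> r \<le> n \<longrightarrow>
      (\<forall>query :: nat query_procedure.
        \<exists>(G :: nat pair_pre_digraph) S.
          pair_digraph G \<and> pverts G = {0..<n} \<and> S \<subseteq> pverts G \<and> card S = r \<and>
          (\<forall>D. ft_reachability_oracle 2 query G (S \<times> S) D \<longrightarrow>
             2 \<le> r \<longrightarrow> real (length D) \<ge> c * real n * real (card S))))"
proof (intro exI[of _ "1 / 12"] conjI allI impI)
  fix n r :: nat and query :: "nat query_procedure"
  assume "0 < n" "0 < r" "r \<le> n"
  define p m where "p = r div 2" and "m = n div (2 * (r div 2))"
  have n: "2 * p * m \<le> n"
    unfolding p_def m_def by (rule times_div_less_eq_dividend)
  define T where "T = (\<lambda>i. vtx m i 0) ` {..<p} \<union> (\<lambda>j. vtx m (p + j) (m - 1)) ` {..<p}"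
  \<comment> \<open>For \<open>r = 1\<close> both \<open>p\<close> and \<open>m\<close> are 0, the
    latter as a division by zero; \<open>T\<close> is then empty.\<close>
  have m: "0 < m" if "0 < p"
    using that \<open>r \<le> n\<close> unfolding p_def m_def by (auto simp: div_greater_zero_iff)
  have "T \<subseteq> {0..<n}"
    unfolding T_def using m by (auto intro!: vtx_less[OF _ _ n])
  moreover have "card T \<le> r"
  proof -
    have "card T \<le> p + p"
      unfolding T_def by (rule order_trans[OF card_Un_le add_mono])
        (use card_image_le[of "{..<p}"] in auto)
    then show ?thesis
      unfolding p_def by simp
  qed
  \<comment> \<open>The endpoints number at most \<open>2 * p \<le> r\<close>; arbitrary further
    vertices pad them to exactly \<open>r\<close>, which only adds query pairs.\<close>
  ultimately obtain S where S: "T \<subseteq> S" "S \<subseteq> {0..<n}" "card S = r"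
    using exists_subset_between[of T r "{0..<n}"] \<open>r \<le> n\<close> by auto
  obtain B where B: "B \<subseteq> slots p m"
    and len: "\<And>D. ft_reachability_oracle 2 query (ladder n p m B) (S \<times> S) D \<Longrightarrow>
      p * p * m \<le> length D"
    by (rule ladder_oracle_length[OF n, of S query]) (use S(1) in \<open>auto simp: T_def\<close>)
  show "\<exists>(G :: nat pair_pre_digraph) S.
          pair_digraph G \<and> pverts G = {0..<n} \<and> S \<subseteq> pverts G \<and> card S = r \<and>
          (\<forall>D. ft_reachability_oracle 2 query G (S \<times> S) D \<longrightarrow>
             2 \<le> r \<longrightarrow> real (length D) \<ge> 1 / 12 * real n * real (card S))"
  proof (intro exI[of _ "ladder n p m B"] exI[of _ S] conjI allI impI)
    show "pair_digraph (ladder n p m B)"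
      by (rule pair_digraph_ladder[OF n B])
    show "pverts (ladder n p m B) = {0..<n}" "S \<subseteq> pverts (ladder n p m B)" "card S = r"
      using S by (simp_all add: ladder_def)
    fix D assume D: "ft_reachability_oracle 2 query (ladder n p m B) (S \<times> S) D" and "2 \<le> r"
    have "n * r \<le> 12 * (p * p * m)"
      unfolding p_def m_def by (rule bits_lower_bound[OF \<open>2 \<le> r\<close> \<open>r \<le> n\<close>])
    also have "\<dots> \<le> 12 * length D"
      using len[OF D] by simp
    finally have "real (n * r) \<le> real (12 * length D)"
      by (rule of_nat_mono)
    then show "real (length D) \<ge> 1 / 12 * real n * real (card S)"
      using S(3) by simp
  qed
qed simp

end
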